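(* Let $n\ge 1$ be an integer, let $\mathcal{M}_n:=\{M\in\mathbb{R}^{n\times n}\mid M=M^{\prime}\geq 0\}$ be the cone of real symmetric non-negative definite $n\times n$ matrices, and let $\mathcal{T}_n:=\{M\in\mathcal{M}_n\mid M\text{ is a Toeplitz matrix}\}$. For $M_1,M_2\in\mathcal{T}_n$ let $$\tau_{\mathcal{T}}(M_1,M_2):=\min\left\{\tfrac{1}{n}\operatorname{trace}(M)\;\middle|\; M\in\mathcal{T}_n,\ M\geq M_1\text{ and } M\geq M_2\right\}.$$ Then $$\delta_{\mathcal{T}}(M_1,M_2):=2\tau_{\mathcal{T}}(M_1,M_2)-\tfrac1n\operatorname{trace}(M_1)-\tfrac1n\operatorname{trace}(M_2)$$ defines a metric on $\mathcal{T}_n$.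
   Context: $M^{\prime}$ denotes the transpose of $M$. For real symmetric matrices $A,B$, $A\geq B$ means that $A-B$ is non-negative definite (positive semidefinite). A matrix is Toeplitz if its $(i,k)$ entry depends only on $k-i$. *)

theory Defs
  imports "HOL-Analysis.Abstract_Metric_Spaces" "Jordan_Normal_Form.Matrix"
begin

definition nonneg_definite :: "nat \<Rightarrow> real mat \<Rightarrow> bool" where
  "nonneg_definite n A \<longleftrightarrow> (\<forall>v \<in> carrier_vec n. 0 \<le> scalar_prod v (A *\<^sub>v v))"

definition loewner_le :: "nat \<Rightarrow> real mat \<Rightarrow> real mat \<Rightarrow> bool" where
  "loewner_le n A B \<longleftrightarrow> nonneg_definite n (B - A)"

definition psd_cone :: "nat \<Rightarrow> real mat set" where
  "psd_cone n = {M \<in> carrier_mat n n. transpose_mat M = M \<and> nonneg_definite n M}"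

definition is_toeplitz :: "'a mat \<Rightarrow> bool" where
  "is_toeplitz M \<longleftrightarrow>
     (\<exists>t :: int \<Rightarrow> 'a. \<forall>i < dim_row M. \<forall>k < dim_col M. M $$ (i, k) = t (int k - int i))"

definition toeplitz_cone :: "nat \<Rightarrow> real mat set" where
  "toeplitz_cone n = {M \<in> psd_cone n. is_toeplitz M}"

definition mat_trace :: "'a :: comm_monoid_add mat \<Rightarrow> 'a" where
  "mat_trace A = (\<Sum>i < dim_row A. A $$ (i, i))"

definition toeplitz_majorants :: "nat \<Rightarrow> real mat \<Rightarrow> real mat \<Rightarrow> real mat set" where
  "toeplitz_majorants n M1 M2 =
     {M \<in> toeplitz_cone n. loewner_le n M1 M \<and> loewner_le n M2 M}"

(* LEAST is the minimum of a set of reals, as opposed to its infimum: it is an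
   unspecified real number when no minimum is attained. *)
definition tau_toeplitz :: "nat \<Rightarrow> real mat \<Rightarrow> real mat \<Rightarrow> real" where
  "tau_toeplitz n M1 M2 =
     (LEAST t. \<exists>M \<in> toeplitz_majorants n M1 M2. t = mat_trace M / real n)"

definition delta_toeplitz :: "nat \<Rightarrow> real mat \<Rightarrow> real mat \<Rightarrow> real" where
  "delta_toeplitz n M1 M2 =
     2 * tau_toeplitz n M1 M2 - mat_trace M1 / real n - mat_trace M2 / real n"

(* The locale Metric_space demands nonnegativity and symmetry of the distance on the
   whole type, not only on the carrier. Extending a function on S by 0 makes
   these demands hold off S, so that Metric_space S (extend_zero S d) says precisely that d
   restricted to S is a metric. *)
definition extend_zero :: "'a set \<Rightarrow> ('a \<Rightarrow> 'a \<Rightarrow> real) \<Rightarrow> 'a \<Rightarrow> 'a \<Rightarrow> real" where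
  "extend_zero S d x y = (if x \<in> S \<and> y \<in> S then d x y else 0)"

end

theory Submission
  imports Defs "HOL-Analysis.Function_Topology"
begin

text \<open>
  A positive semidefinite Toeplitz matrix is determined by its first row, whose entries are
  bounded by the diagonal entry. Hence the majorants of small trace form a compact set and the
  minimum is attained. If \<open>M\<close> majorizes \<open>M1\<close> and has the same trace, the positive semidefinite
  Toeplitz matrix \<open>M - M1\<close> has zero diagonal and so vanishes; this makes the distance definite.
  For the triangle inequality, if \<open>M\<close> majorizes \<open>A\<close> and \<open>B\<close>, and \<open>N\<close> majorizes \<open>B\<close> and
  \<open>C\<close>, then \<open>M + N - B\<close> is a Toeplitz majorant of \<open>A\<close> and \<open>C\<close>.
\<close>

unbundle no vec_syntax

section \<open>Quadratic forms and the Loewner order\<close>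

lemma quadratic_form_sum:
  assumes "A \<in> carrier_mat n n" "v \<in> carrier_vec n"
  shows "scalar_prod v (A *\<^sub>v v) = (\<Sum>i<n. \<Sum>k<n. v $ i * (A $$ (i, k) * v $ k))"
  using assms by (auto simp: scalar_prod_def sum_distrib_left atLeast0LessThan)

lemma nonneg_definite_add:
  assumes "A \<in> carrier_mat n n" "B \<in> carrier_mat n n"
    and "nonneg_definite n A" "nonneg_definite n B"
  shows "nonneg_definite n (A + B)"
  unfolding nonneg_definite_def
proof
  fix v :: "real vec" assume v: "v \<in> carrier_vec n"
  have "scalar_prod v ((A + B) *\<^sub>v v) = scalar_prod v (A *\<^sub>v v) + scalar_prod v (B *\<^sub>v v)"
    using assms(1,2) v
    by (simp add: add_mult_distrib_mat_vec[of _ n n] scalar_prod_add_distrib[of _ n])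
  then show "0 \<le> scalar_prod v ((A + B) *\<^sub>v v)"
    using assms(3,4) v by (simp add: nonneg_definite_def)
qed

lemma loewner_le_refl:
  assumes "A \<in> carrier_mat n n"
  shows "loewner_le n A A"
  using assms by (simp add: loewner_le_def nonneg_definite_def quadratic_form_sum[of _ n])

lemma loewner_le_add_mono:
  assumes "A \<in> carrier_mat n n" "B \<in> carrier_mat n n" "C \<in> carrier_mat n n" "D \<in> carrier_mat n n"
    and "loewner_le n A C" "loewner_le n B D"
  shows "loewner_le n (A + B) (C + D)"
proof -
  have "C + D - (A + B) = (C - A) + (D - B)"
    using assms(1-4) by (intro eq_matI) auto
  then show ?thesis
    using assms unfolding loewner_le_def
    by (simp add: nonneg_definite_add minus_carrier_mat)
qed

lemma loewner_le_add_right: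
  assumes "A \<in> carrier_mat n n" "B \<in> carrier_mat n n" "nonneg_definite n B"
  shows "loewner_le n A (A + B)"
proof -
  have "A + B - A = B"
    using assms by (intro eq_matI) auto
  then show ?thesis
    using assms by (simp add: loewner_le_def)
qed

lemma nonneg_definite_loewner_le:
  assumes "A \<in> carrier_mat n n" "B \<in> carrier_mat n n" "nonneg_definite n A" "loewner_le n A B"
  shows "nonneg_definite n B"
proof -
  have "A + (B - A) = B"
    using assms by (intro eq_matI) auto
  moreover have "nonneg_definite n (A + (B - A))"
    using assms by (intro nonneg_definite_add) (auto simp: loewner_le_def)
  ultimately show ?thesis by simp
qed

text \<open>Evaluate the quadratic form at \<open>e_i + r e_k\<close>: for \<open>r = 1\<close>
  nonnegativity bounds \<open>A $$ (i, k)\<close> from below, for \<open>r = -1\<close> from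
  above.\<close>

lemma psd_entry_bound:
  assumes A: "A \<in> psd_cone n" and i: "i < n" and k: "k < n"
  shows "2 * \<bar>A $$ (i, k)\<bar> \<le> A $$ (i, i) + A $$ (k, k)"
proof -
  have c: "A \<in> carrier_mat n n" and s: "transpose_mat A = A" and p: "nonneg_definite n A"
    using A by (auto simp: psd_cone_def)
  have ki: "A $$ (k, i) = A $$ (i, k)"
    using s c i k by (metis carrier_matD index_transpose_mat(1))
  have form: "scalar_prod (u + v) (A *\<^sub>v (u + v))
      = scalar_prod u (A *\<^sub>v u) + scalar_prod u (A *\<^sub>v v)
        + scalar_prod v (A *\<^sub>v u) + scalar_prod v (A *\<^sub>v v)"
    if "u \<in> carrier_vec n" "v \<in> carrier_vec n" for u v
    using that c
    by (simp add: mult_add_distrib_mat_vec[of _ n n] scalar_prod_add_distrib[of _ n]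
        add_scalar_prod_distrib[of _ n])
  have entry: "scalar_prod (unit_vec n a) (A *\<^sub>v unit_vec n b) = A $$ (a, b)"
    if "a < n" "b < n" for a b
    using that c by (simp add: mult_mat_vec_carrier[of _ n n])
  have "0 \<le> A $$ (i, i) + 2 * (r * A $$ (i, k)) + r * r * A $$ (k, k)" for r
  proof -
    let ?v = "r \<cdot>\<^sub>v unit_vec n k"
    have Av: "A *\<^sub>v ?v = r \<cdot>\<^sub>v (A *\<^sub>v unit_vec n k)"
      using c by (simp add: mult_mat_vec[of _ n n])
    have "0 \<le> scalar_prod (unit_vec n i + ?v) (A *\<^sub>v (unit_vec n i + ?v))"
      using p by (simp add: nonneg_definite_def)
    also have "\<dots> = A $$ (i, i) + r * A $$ (i, k) + r * A $$ (k, i) + r * (r * A $$ (k, k))"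
      using c i k by (simp add: form Av entry mult_mat_vec_carrier[of _ n n]
          smult_scalar_prod_distrib[of _ n] scalar_prod_smult_distrib[of _ n])
    finally show ?thesis by (simp add: ki)
  qed
  from this[of 1] this[of "-1"] show ?thesis by simp
qed

section \<open>The cone of Toeplitz matrices and its parametrization by sequences\<close>

lemma is_toeplitz_add:
  assumes "A \<in> carrier_mat n n" "B \<in> carrier_mat n n" "is_toeplitz A" "is_toeplitz B"
  shows "is_toeplitz (A + B)"
proof -
  obtain s t where "\<forall>i<n. \<forall>k<n. A $$ (i, k) = s (int k - int i)"
    "\<forall>i<n. \<forall>k<n. B $$ (i, k) = t (int k - int i)"
    using assms by (auto simp: is_toeplitz_def)
  then show ?thesis
    using assms(1,2) unfolding is_toeplitz_def by (intro exI[of _ "\<lambda>d. s d + t d"]) auto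
qed

lemma is_toeplitz_minus:
  fixes A B :: "'a :: group_add mat"
  assumes "A \<in> carrier_mat n n" "B \<in> carrier_mat n n" "is_toeplitz A" "is_toeplitz B"
  shows "is_toeplitz (A - B)"
proof -
  obtain s t where "\<forall>i<n. \<forall>k<n. A $$ (i, k) = s (int k - int i)"
    "\<forall>i<n. \<forall>k<n. B $$ (i, k) = t (int k - int i)"
    using assms by (auto simp: is_toeplitz_def)
  then show ?thesis
    using assms(1,2) unfolding is_toeplitz_def by (intro exI[of _ "\<lambda>d. s d - t d"]) auto
qed

lemma toeplitz_coneD:
  assumes "M \<in> toeplitz_cone n"
  shows "M \<in> carrier_mat n n" "transpose_mat M = M" "nonneg_definite n M" "is_toeplitz M"
  using assms by (auto simp: toeplitz_cone_def psd_cone_def)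

lemma toeplitz_cone_add:
  assumes "A \<in> toeplitz_cone n" "B \<in> toeplitz_cone n"
  shows "A + B \<in> toeplitz_cone n"
  using assms[THEN toeplitz_coneD(1)] assms[THEN toeplitz_coneD(2)]
    assms[THEN toeplitz_coneD(3)] assms[THEN toeplitz_coneD(4)]
  by (simp add: toeplitz_cone_def psd_cone_def transpose_add[of _ n n] nonneg_definite_add
      is_toeplitz_add)

lemma toeplitz_cone_minus:
  assumes "A \<in> toeplitz_cone n" "B \<in> toeplitz_cone n" "loewner_le n B A"
  shows "A - B \<in> toeplitz_cone n"
  using assms(3) assms(1,2)[THEN toeplitz_coneD(1)] assms(1,2)[THEN toeplitz_coneD(2)]
    assms(1,2)[THEN toeplitz_coneD(4)]
  by (simp add: toeplitz_cone_def psd_cone_def transpose_minus[of _ n n] loewner_le_def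
      is_toeplitz_minus minus_carrier_mat)

lemma toeplitz_diagonal:
  assumes "M \<in> carrier_mat n n" "is_toeplitz M" "i < n"
  shows "M $$ (i, i) = M $$ (0, 0)"
  using assms by (auto simp: is_toeplitz_def)

text \<open>The diagonal is constant, so its average is the corner entry. From here on
  \<open>M $$ (0, 0)\<close> stands in for the normalized trace, which makes the objective a single
  coordinate.\<close>

lemma toeplitz_trace:
  fixes M :: "real mat"
  assumes "M \<in> carrier_mat n n" "is_toeplitz M" "n \<ge> 1"
  shows "mat_trace M / real n = M $$ (0, 0)"
proof -
  have "mat_trace M = (\<Sum>i<n. M $$ (0, 0))"
    unfolding mat_trace_def
    by (rule sum.cong) (use assms(1) in \<open>auto intro: toeplitz_diagonal[OF _ assms(2)]\<close>)
  then show ?thesis using assms(3) by simp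
qed

text \<open>Both diagonal entries in \<open>psd_entry_bound\<close> equal the corner entry. This
  control of the whole matrix by one number gives both the compactness and the definiteness
  below.\<close>

lemma toeplitz_cone_entry_bound:
  assumes "M \<in> toeplitz_cone n" "i < n" "k < n"
  shows "\<bar>M $$ (i, k)\<bar> \<le> M $$ (0, 0)"
  using psd_entry_bound[of M n i k] assms toeplitz_diagonal[of M n i] toeplitz_diagonal[of M n k]
    toeplitz_coneD[OF assms(1)]
  by (simp add: toeplitz_cone_def)

text \<open>Full sequences serve as parameters so that the minimization can take place in a function
  space with the product topology; only the values below \<open>n\<close> enter. The absolute value
  builds in symmetry.\<close>

definition toeplitz_of :: "nat \<Rightarrow> (nat \<Rightarrow> 'a) \<Rightarrow> 'a mat" where
  "toeplitz_of n f = mat n n (\<lambda>(i, k). f (nat \<bar>int k - int i\<bar>))"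

lemma toeplitz_of_carrier [simp]: "toeplitz_of n f \<in> carrier_mat n n"
  by (simp add: toeplitz_of_def)

lemma toeplitz_of_index: "i < n \<Longrightarrow> k < n \<Longrightarrow> toeplitz_of n f $$ (i, k) = f (nat \<bar>int k - int i\<bar>)"
  by (simp add: toeplitz_of_def)

lemma is_toeplitz_toeplitz_of: "is_toeplitz (toeplitz_of n f)"
  unfolding is_toeplitz_def by (rule exI[of _ "\<lambda>d. f (nat \<bar>d\<bar>)"]) (auto simp: toeplitz_of_def)

lemma transpose_toeplitz_of: "transpose_mat (toeplitz_of n f) = toeplitz_of n f"
  by (rule eq_matI) (auto simp: toeplitz_of_def abs_minus_commute)

text \<open>Symmetry folds negative offsets onto positive ones, so the first row already contains
  every entry.\<close>

lemma toeplitz_of_first_row: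
  assumes "M \<in> carrier_mat n n" "transpose_mat M = M" "is_toeplitz M"
    and f: "\<And>k. k < n \<Longrightarrow> f k = M $$ (0, k)"
  shows "toeplitz_of n f = M"
proof (rule eq_matI)
  obtain t where t: "\<And>i k. i < n \<Longrightarrow> k < n \<Longrightarrow> M $$ (i, k) = t (int k - int i)"
    using assms(1,3) by (auto simp: is_toeplitz_def)
  fix i k assume "i < dim_row M" "k < dim_col M"
  then have ik: "i < n" "k < n" using assms(1) by auto
  have sym: "M $$ (i, k) = M $$ (k, i)"
    using assms(1,2) ik by (metis carrier_matD index_transpose_mat(1))
  \<comment> \<open>As \<open>i\<close> and \<open>k\<close> are below \<open>n\<close>, so is the
    distance between them, and row 0 has an entry at that position.\<close>
  have "f (nat \<bar>int k - int i\<bar>) = t \<bar>int k - int i\<bar>"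
    using ik f[of "nat \<bar>int k - int i\<bar>"] t[of 0 "nat \<bar>int k - int i\<bar>"] by auto
  also have "\<dots> = M $$ (i, k)"
  proof (cases "i \<le> k")
    case True
    then show ?thesis using t[OF ik] by simp
  next
    case False
    then show ?thesis using t[OF ik(2,1)] sym by simp
  qed
  finally show "toeplitz_of n f $$ (i, k) = M $$ (i, k)"
    using ik by (simp add: toeplitz_of_index)
qed (use assms(1) in \<open>auto simp: toeplitz_of_def\<close>)

section \<open>Compactness and attainment of the minimum\<close>

lemma closed_loewner_le_toeplitz_of:
  assumes B: "B \<in> carrier_mat n n"
  shows "closed {f. loewner_le n B (toeplitz_of n f)}"
proof -
  have "scalar_prod v ((toeplitz_of n f - B) *\<^sub>v v) =
      (\<Sum>i<n. \<Sum>k<n. v $ i * ((f (nat \<bar>int k - int i\<bar>) - B $$ (i, k)) * v $ k))"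
    if "v \<in> carrier_vec n" for v f
    using B that
    by (auto simp: quadratic_form_sum[of _ n] minus_carrier_mat toeplitz_of_index
        intro!: sum.cong)
  \<comment> \<open>For fixed \<open>v\<close> the form is affine in finitely many values of
    \<open>f\<close>, hence continuous for pointwise convergence; the order relation is an
    intersection of such closed conditions.\<close>
  then have "{f. loewner_le n B (toeplitz_of n f)} = (\<Inter>v\<in>carrier_vec n.
      {f. 0 \<le> (\<Sum>i<n. \<Sum>k<n. v $ i * ((f (nat \<bar>int k - int i\<bar>) - B $$ (i, k)) * v $ k))})"
    by (auto simp: loewner_le_def nonneg_definite_def)
  moreover have "closed {f. 0 \<le> (\<Sum>i<n. \<Sum>k<n. v $ i * ((f (nat \<bar>int k - int i\<bar>) - B $$ (i, k)) * v $ k))}"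
    for v
    by (intro closed_Collect_le continuous_intros continuous_on_product_coordinates)
  ultimately show ?thesis by auto
qed

text \<open>A matrix above the semidefinite \<open>M1\<close> is itself semidefinite, and symmetry
  and Toeplitz form are built into \<open>toeplitz_of\<close>. So only two closed conditions on
  \<open>f\<close> remain.\<close>

lemma toeplitz_of_majorants_iff:
  assumes "M1 \<in> toeplitz_cone n"
  shows "toeplitz_of n f \<in> toeplitz_majorants n M1 M2 \<longleftrightarrow>
    loewner_le n M1 (toeplitz_of n f) \<and> loewner_le n M2 (toeplitz_of n f)"
  using nonneg_definite_loewner_le[OF toeplitz_coneD(1)[OF assms] toeplitz_of_carrier
      toeplitz_coneD(3)[OF assms]]
  by (auto simp: toeplitz_majorants_def toeplitz_cone_def psd_cone_def is_toeplitz_toeplitz_of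
      transpose_toeplitz_of)

text \<open>Tychonoff's theorem: the set is a product of copies of the interval from
  \<open>-c\<close> to \<open>c\<close>.\<close>

lemma compact_bounded_functions: "compact {f :: 'a \<Rightarrow> real. \<forall>k. \<bar>f k\<bar> \<le> c}"
proof -
  have "compactin (product_topology (\<lambda>_. euclidean) (UNIV :: 'a set)) (PiE UNIV (\<lambda>_. {-c..c}))"
    unfolding compactin_PiE by (simp add: compactin_euclidean_iff)
  moreover have "PiE UNIV (\<lambda>_. {-c..c}) = {f :: 'a \<Rightarrow> real. \<forall>k. \<bar>f k\<bar> \<le> c}"
    by (auto simp: PiE_def Pi_def abs_le_iff minus_le_iff)
  ultimately show ?thesis
    by (simp add: euclidean_product_topology compactin_euclidean_iff)
qed

text \<open>Adding a semidefinite summand only enlarges the other one. This provides a majorant to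
  start the minimization from.\<close>

lemma add_mem_toeplitz_majorants:
  assumes "M1 \<in> toeplitz_cone n" "M2 \<in> toeplitz_cone n"
  shows "M1 + M2 \<in> toeplitz_majorants n M1 M2"
proof -
  note M1 = toeplitz_coneD[OF assms(1)] and M2 = toeplitz_coneD[OF assms(2)]
  have "loewner_le n M2 (M1 + M2)"
    using loewner_le_add_right[OF M2(1) M1(1,3)] comm_add_mat[OF M1(1) M2(1)] by simp
  then show ?thesis
    using M1 M2 assms
    by (simp add: toeplitz_majorants_def toeplitz_cone_add loewner_le_add_right)
qed

lemma toeplitz_majorants_attain_min:
  assumes n: "n \<ge> 1" and M1: "M1 \<in> toeplitz_cone n" and M2: "M2 \<in> toeplitz_cone n"
  obtains M where "M \<in> toeplitz_majorants n M1 M2"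
    "\<And>N. N \<in> toeplitz_majorants n M1 M2 \<Longrightarrow> M $$ (0, 0) \<le> N $$ (0, 0)"
proof -
  \<comment> \<open>The objective value of the known majorant \<open>M1 + M2\<close>: only majorants
    with corner entry at most \<open>c\<close> can compete, and their entries are all bounded by
    \<open>c\<close>.\<close>
  define c where "c = (M1 + M2) $$ (0, 0)"
  define S where "S = {f. \<forall>k. \<bar>f k\<bar> \<le> c} \<inter>
    ({f. loewner_le n M1 (toeplitz_of n f)} \<inter> {f. loewner_le n M2 (toeplitz_of n f)})"
  define row where "row N = (\<lambda>k. if k < n then N $$ (0, k) else 0)" for N :: "real mat"
  have row: "toeplitz_of n (row N) = N" if "N \<in> toeplitz_majorants n M1 M2" for N
    using that by (intro toeplitz_of_first_row)
      (auto simp: toeplitz_majorants_def row_def dest: toeplitz_coneD)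
  have row_S: "row N \<in> S" if N: "N \<in> toeplitz_majorants n M1 M2" "N $$ (0, 0) \<le> c" for N
  proof -
    have "N \<in> toeplitz_cone n" using N by (simp add: toeplitz_majorants_def)
    then have "\<bar>N $$ (0, k)\<bar> \<le> N $$ (0, 0)" if "k < n" for k
      using toeplitz_cone_entry_bound[of N n 0 k] that by simp
    \<comment> \<open>The instance at 0 gives \<open>0 \<le> N $$ (0, 0) \<le> c\<close>, which
      covers the default value 0 of \<open>row N\<close> beyond the matrix.\<close>
    from this this[of 0] have "\<bar>row N k\<bar> \<le> c" for k
      using N(2) n by (force simp: row_def)
    then show ?thesis
      using N(1) row[OF N(1)] by (simp add: S_def toeplitz_majorants_def)
  qed
  have "compact S"
    unfolding S_def using M1 M2
    by (intro compact_Int_closed compact_bounded_functions closed_Int closed_loewner_le_toeplitz_of)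
      (auto dest: toeplitz_coneD)
  moreover have "S \<noteq> {}"
    using row_S[OF add_mem_toeplitz_majorants[OF M1 M2]] by (auto simp: c_def)
  moreover have "continuous_on S (\<lambda>f. f 0)"
    by (rule continuous_on_subset[OF continuous_on_product_coordinates]) auto
  ultimately obtain f where f: "f \<in> S" "\<And>g. g \<in> S \<Longrightarrow> f 0 \<le> g 0"
    using continuous_attains_inf[of S "\<lambda>f. f 0"] by blast
  have f0: "toeplitz_of n f $$ (0, 0) = f 0"
    using n by (simp add: toeplitz_of_index)
  show thesis
  proof
    show "toeplitz_of n f \<in> toeplitz_majorants n M1 M2"
      using f(1) by (simp add: toeplitz_of_majorants_iff[OF M1] S_def)
    fix N assume N: "N \<in> toeplitz_majorants n M1 M2"
    show "toeplitz_of n f $$ (0, 0) \<le> N $$ (0, 0)"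
    proof (cases "N $$ (0, 0) \<le> c")
      case True
      then show ?thesis
        using f(2)[OF row_S[OF N]] f0 n by (simp add: row_def)
    next
      \<comment> \<open>Such an \<open>N\<close> lies outside the search region, but the minimizer
        found there has value at most \<open>c\<close>.\<close>
      case False
      have "f 0 \<le> c" using f(1) by (auto simp: S_def dest: abs_le_D1)
      then show ?thesis using False f0 by simp
    qed
  qed
qed

text \<open>The minimizer's corner entry is a value of the objective and a lower bound for all of
  them, so it is what \<open>LEAST\<close> denotes.\<close>

lemma tau_toeplitz_attained:
  assumes n: "n \<ge> 1" and M1: "M1 \<in> toeplitz_cone n" and M2: "M2 \<in> toeplitz_cone n"
  obtains M where "M \<in> toeplitz_majorants n M1 M2" "tau_toeplitz n M1 M2 = M $$ (0, 0)"
    "\<And>N. N \<in> toeplitz_majorants n M1 M2 \<Longrightarrow> M $$ (0, 0) \<le> N $$ (0, 0)"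
proof -
  have tr: "mat_trace N / real n = N $$ (0, 0)" if "N \<in> toeplitz_majorants n M1 M2" for N
    using that n by (auto simp: toeplitz_majorants_def dest: toeplitz_coneD intro!: toeplitz_trace)
  obtain M where M: "M \<in> toeplitz_majorants n M1 M2"
    "\<And>N. N \<in> toeplitz_majorants n M1 M2 \<Longrightarrow> M $$ (0, 0) \<le> N $$ (0, 0)"
    using toeplitz_majorants_attain_min[OF assms] by blast
  have "tau_toeplitz n M1 M2 = M $$ (0, 0)"
    unfolding tau_toeplitz_def
    by (rule Least_equality) (use M tr in force)+
  with M show thesis using that by blast
qed

lemma tau_toeplitz_le:
  assumes "n \<ge> 1" "M1 \<in> toeplitz_cone n" "M2 \<in> toeplitz_cone n" "N \<in> toeplitz_majorants n M1 M2"
  shows "tau_toeplitz n M1 M2 \<le> N $$ (0, 0)"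
  using tau_toeplitz_attained[OF assms(1-3)] assms(4) by metis

section \<open>The metric axioms\<close>

lemma tau_toeplitz_commute: "tau_toeplitz n M1 M2 = tau_toeplitz n M2 M1"
proof -
  have "toeplitz_majorants n M1 M2 = toeplitz_majorants n M2 M1"
    by (auto simp: toeplitz_majorants_def)
  then show ?thesis by (simp add: tau_toeplitz_def)
qed

lemma delta_toeplitz_eq:
  assumes "n \<ge> 1" "M1 \<in> toeplitz_cone n" "M2 \<in> toeplitz_cone n"
  shows "delta_toeplitz n M1 M2 = 2 * tau_toeplitz n M1 M2 - M1 $$ (0, 0) - M2 $$ (0, 0)"
  using assms by (simp add: delta_toeplitz_def toeplitz_trace toeplitz_coneD)

text \<open>\<open>B - A\<close> lies in the cone, and its corner entry dominates an absolute
  value.\<close>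

lemma toeplitz_loewner_le_diagonal:
  assumes "n \<ge> 1" "A \<in> toeplitz_cone n" "B \<in> toeplitz_cone n" "loewner_le n A B"
  shows "A $$ (0, 0) \<le> B $$ (0, 0)"
  using toeplitz_cone_entry_bound[OF toeplitz_cone_minus[OF assms(3,2,4)], of 0 0]
    toeplitz_coneD(1)[OF assms(2)] toeplitz_coneD(1)[OF assms(3)] assms(1) by auto

lemma toeplitz_loewner_le_eqI:
  assumes A: "A \<in> toeplitz_cone n" and B: "B \<in> toeplitz_cone n"
    and "loewner_le n A B" "A $$ (0, 0) = B $$ (0, 0)"
  shows "A = B"
proof (rule eq_matI)
  note cA = toeplitz_coneD(1)[OF A] and cB = toeplitz_coneD(1)[OF B]
  fix i k assume "i < dim_row B" "k < dim_col B"
  then have ik: "i < n" "k < n" using cB by auto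
  \<comment> \<open>The right-hand side is 0 because the corner entries agree.\<close>
  have "\<bar>(B - A) $$ (i, k)\<bar> \<le> (B - A) $$ (0, 0)"
    using toeplitz_cone_minus[OF B A assms(3)] ik by (rule toeplitz_cone_entry_bound)
  then show "A $$ (i, k) = B $$ (i, k)"
    using assms(4) cA cB ik by auto
qed (use toeplitz_coneD(1)[OF A] toeplitz_coneD(1)[OF B] in auto)

lemma tau_toeplitz_ge:
  assumes n: "n \<ge> 1" and M1: "M1 \<in> toeplitz_cone n" and M2: "M2 \<in> toeplitz_cone n"
  shows "M1 $$ (0, 0) \<le> tau_toeplitz n M1 M2" "M2 $$ (0, 0) \<le> tau_toeplitz n M1 M2"
proof -
  obtain M where "M \<in> toeplitz_majorants n M1 M2" "tau_toeplitz n M1 M2 = M $$ (0, 0)"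
    using tau_toeplitz_attained[OF assms] by blast
  then show "M1 $$ (0, 0) \<le> tau_toeplitz n M1 M2" "M2 $$ (0, 0) \<le> tau_toeplitz n M1 M2"
    using assms by (auto simp: toeplitz_majorants_def intro: toeplitz_loewner_le_diagonal)
qed

lemma delta_toeplitz_nonneg:
  assumes "n \<ge> 1" "M1 \<in> toeplitz_cone n" "M2 \<in> toeplitz_cone n"
  shows "0 \<le> delta_toeplitz n M1 M2"
  using tau_toeplitz_ge[OF assms] by (simp add: delta_toeplitz_eq[OF assms])

lemma delta_toeplitz_self:
  assumes "n \<ge> 1" "M \<in> toeplitz_cone n"
  shows "delta_toeplitz n M M = 0"
proof -
  have "M \<in> toeplitz_majorants n M M"
    using assms by (simp add: toeplitz_majorants_def loewner_le_refl toeplitz_coneD)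
  then have "tau_toeplitz n M M \<le> M $$ (0, 0)"
    using assms by (intro tau_toeplitz_le)
  with tau_toeplitz_ge[of n M M] show ?thesis
    using assms by (simp add: delta_toeplitz_eq)
qed

lemma delta_toeplitz_eq_0_imp_eq:
  assumes n: "n \<ge> 1" and M1: "M1 \<in> toeplitz_cone n" and M2: "M2 \<in> toeplitz_cone n"
    and zero: "delta_toeplitz n M1 M2 = 0"
  shows "M1 = M2"
proof -
  obtain M where M: "M \<in> toeplitz_majorants n M1 M2" "tau_toeplitz n M1 M2 = M $$ (0, 0)"
    using tau_toeplitz_attained[OF n M1 M2] by blast
  \<comment> \<open>The distance is the sum of the gaps from \<open>M1 $$ (0, 0)\<close> and from
    \<open>M2 $$ (0, 0)\<close> up to \<open>tau_toeplitz n M1 M2\<close>. Both are nonnegative, so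
    both vanish.\<close>
  have "M1 $$ (0, 0) = M $$ (0, 0)" "M2 $$ (0, 0) = M $$ (0, 0)"
    using tau_toeplitz_ge[OF n M1 M2] zero M(2) delta_toeplitz_eq[OF n M1 M2] by auto
  then have "M1 = M" "M2 = M"
    using M(1) M1 M2 by (auto simp: toeplitz_majorants_def intro: toeplitz_loewner_le_eqI)
  then show ?thesis by simp
qed

lemma delta_toeplitz_triangle:
  assumes n: "n \<ge> 1"
    and A: "A \<in> toeplitz_cone n" and B: "B \<in> toeplitz_cone n" and C: "C \<in> toeplitz_cone n"
  shows "delta_toeplitz n A C \<le> delta_toeplitz n A B + delta_toeplitz n B C"
proof -
  obtain M where M: "M \<in> toeplitz_majorants n A B" and tM: "tau_toeplitz n A B = M $$ (0, 0)"
    using tau_toeplitz_attained[OF n A B] by blast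
  obtain N where N: "N \<in> toeplitz_majorants n B C" and tN: "tau_toeplitz n B C = N $$ (0, 0)"
    using tau_toeplitz_attained[OF n B C] by blast
  have M': "M \<in> toeplitz_cone n" "loewner_le n A M" "loewner_le n B M"
    and N': "N \<in> toeplitz_cone n" "loewner_le n B N" "loewner_le n C N"
    using M N by (auto simp: toeplitz_majorants_def)
  note c = toeplitz_coneD(1)[OF A] toeplitz_coneD(1)[OF B] toeplitz_coneD(1)[OF C]
    toeplitz_coneD(1)[OF M'(1)] toeplitz_coneD(1)[OF N'(1)]
  \<comment> \<open>This bracketing shows a sum of two cone members, since \<open>N\<close>
    dominates \<open>B\<close>.\<close>
  let ?P = "M + (N - B)"
  have P: "?P \<in> toeplitz_cone n"
    using M' N' B by (intro toeplitz_cone_add toeplitz_cone_minus)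
  \<comment> \<open>Regrouping pairs \<open>M\<close> with \<open>A\<close> and \<open>N\<close>
    with \<open>B\<close> in the first case, \<open>M\<close> with \<open>B\<close> and
    \<open>N\<close> with \<open>C\<close> in the second, so that the order relations can be
    added.\<close>
  have "?P - A = M + N - (A + B)" "?P - C = M + N - (B + C)"
    using c by (auto intro!: eq_matI)
  moreover have "loewner_le n (A + B) (M + N)" "loewner_le n (B + C) (M + N)"
    using M' N' c by (auto intro: loewner_le_add_mono)
  ultimately have "?P \<in> toeplitz_majorants n A C"
    using P by (simp add: toeplitz_majorants_def loewner_le_def)
  then have "tau_toeplitz n A C \<le> ?P $$ (0, 0)"
    using n A C by (intro tau_toeplitz_le)
  also have "\<dots> = tau_toeplitz n A B + tau_toeplitz n B C - B $$ (0, 0)"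
    using c n tM tN by auto
  \<comment> \<open>After doubling, the term \<open>- 2 * B $$ (0, 0)\<close> splits evenly between
    the two distances on the right.\<close>
  finally show ?thesis
    using n A B C by (simp add: delta_toeplitz_eq)
qed

text \<open>The first conjunct certifies that \<open>LEAST\<close> names an actual minimum, so that
  the second concerns the intended distance.\<close>

theorem proposition2:
  fixes n :: nat
  assumes "n \<ge> 1"
  shows "(\<forall>M1 \<in> toeplitz_cone n. \<forall>M2 \<in> toeplitz_cone n.
            \<exists>M \<in> toeplitz_majorants n M1 M2.
              tau_toeplitz n M1 M2 = mat_trace M / real n \<and>
              (\<forall>N \<in> toeplitz_majorants n M1 M2. mat_trace M / real n \<le> mat_trace N / real n))
         \<and> Metric_space (toeplitz_cone n) (extend_zero (toeplitz_cone n) (delta_toeplitz n))"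
proof (intro conjI ballI)
  fix M1 M2 assume *: "M1 \<in> toeplitz_cone n" "M2 \<in> toeplitz_cone n"
  have tr: "mat_trace N / real n = N $$ (0, 0)" if "N \<in> toeplitz_majorants n M1 M2" for N
    using that assms
    by (auto simp: toeplitz_majorants_def dest: toeplitz_coneD intro!: toeplitz_trace)
  show "\<exists>M \<in> toeplitz_majorants n M1 M2.
      tau_toeplitz n M1 M2 = mat_trace M / real n \<and>
      (\<forall>N \<in> toeplitz_majorants n M1 M2. mat_trace M / real n \<le> mat_trace N / real n)"
    using tau_toeplitz_attained[OF assms *] tr by metis
next
  show "Metric_space (toeplitz_cone n) (extend_zero (toeplitz_cone n) (delta_toeplitz n))"
  proof
    show "0 \<le> extend_zero (toeplitz_cone n) (delta_toeplitz n) x y" for x y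
      using assms by (simp add: extend_zero_def delta_toeplitz_nonneg)
    show "extend_zero (toeplitz_cone n) (delta_toeplitz n) x y
        = extend_zero (toeplitz_cone n) (delta_toeplitz n) y x" for x y
      by (simp add: extend_zero_def delta_toeplitz_def tau_toeplitz_commute[of n x y])
    show "extend_zero (toeplitz_cone n) (delta_toeplitz n) x y = 0 \<longleftrightarrow> x = y"
      if "x \<in> toeplitz_cone n" "y \<in> toeplitz_cone n" for x y
      using that assms delta_toeplitz_eq_0_imp_eq
      by (auto simp: extend_zero_def delta_toeplitz_self)
    show "extend_zero (toeplitz_cone n) (delta_toeplitz n) x z
        \<le> extend_zero (toeplitz_cone n) (delta_toeplitz n) x y
          + extend_zero (toeplitz_cone n) (delta_toeplitz n) y z"
      if "x \<in> toeplitz_cone n" "y \<in> toeplitz_cone n" "z \<in> toeplitz_cone n" for x y z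
      using that assms by (simp add: extend_zero_def delta_toeplitz_triangle)
  qed
qed

end
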